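(* Let $G$ be a nontrivial finite group. (1) If $|G|=2$ or $|G|$ is odd, then $\mathrm{DNG}(G)=*1$. (2) If $G\cong \mathbb{Z}_{4n}$ for some integer $n\ge 1$, or the set of maximal subgroups of $G$ of even order covers $G$, then $\mathrm{DNG}(G)=*0$. (3) Otherwise, $\mathrm{DNG}(G)=*3$.
   Context: For a nontrivial finite group $G$, the avoidance game $\mathrm{DNG}(G)$ is the impartial game whose positions are the subsets $P\subseteq G$ with $\langle P\rangle\ne G$; the starting position is $\emptyset$; the options of $P$ are the positions of the form $P\cup\{g\}$ with $g\in G\setminus P$ (and $\langle P\cup\{g\}\rangle\neq G$). Two players alternate moves, and a player who cannot move loses (normal play). The nim-number of a position $P$ is defined recursively by $\mathrm{nim}(P)=\mathrm{mex}\{\mathrm{nim}(Q)\mid Q \text{ an option of } P\}$, where $\mathrm{mex}(A)$ is the least non-negative integer not in $A$. The notation $\mathrm{DNG}(G)=*n$ means that the starting position $\emptyset$ has nim-number $n$. $\mathbb{Z}_m$ is the cyclic group of order $m$. A set of subgroups covers $G$ if its union is $G$. *)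

theory Defs
  imports "HOL-Algebra.Algebra"
begin

definition mex :: "nat set \<Rightarrow> nat"
  where "mex A = (LEAST n. n \<notin> A)"

definition dng_positions :: "('a, 'b) monoid_scheme \<Rightarrow> 'a set set"
  where "dng_positions G = {P. P \<subseteq> carrier G \<and> generate G P \<noteq> carrier G}"

definition dng_opts :: "('a, 'b) monoid_scheme \<Rightarrow> 'a set \<Rightarrow> 'a set set"
  where "dng_opts G P = {Q \<in> dng_positions G. \<exists>g \<in> carrier G - P. Q = P \<union> {g}}"

lemma dng_opts_decrease:
  assumes "finite (carrier G)" and "Q \<in> dng_opts G P"
  shows "card (carrier G - Q) < card (carrier G - P)"
  using assms by (intro psubset_card_mono) (auto simp: dng_opts_def)

(* The recursion is well-founded only for a finite carrier; 0 is a junk value for infinite ones. *)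
function dng_nim :: "('a, 'b) monoid_scheme \<Rightarrow> 'a set \<Rightarrow> nat"
  where "dng_nim G P = (if finite (carrier G) then mex (dng_nim G ` dng_opts G P) else 0)"
  by auto
termination
  by (relation "measure (\<lambda>(G, P). card (carrier G - P))") (auto intro: dng_opts_decrease)

declare dng_nim.simps [simp del]

(* The n with DNG(G) = *n; for nontrivial G the empty set is a position. *)
definition DNG :: "('a, 'b) monoid_scheme \<Rightarrow> nat"
  where "DNG G = dng_nim G {}"

definition maximal_subgroup :: "'a set \<Rightarrow> ('a, 'b) monoid_scheme \<Rightarrow> bool"
  where "maximal_subgroup M G \<longleftrightarrow>
    subgroup M G \<and> M \<noteq> carrier G \<and>
    (\<forall>H. subgroup H G \<and> M \<subseteq> H \<longrightarrow> H = M \<or> H = carrier G)"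

definition covers :: "'a set set \<Rightarrow> ('a, 'b) monoid_scheme \<Rightarrow> bool"
  where "covers \<M> G \<longleftrightarrow> \<Union>\<M> = carrier G"

end

theory Submission
  imports Defs
begin

text \<open>
  Every position lies in a maximal subgroup, and play stops exactly when the position is a maximal
  subgroup. Hence only the parities of the maximal subgroups above a position matter. If all of
  them are odd, the number of remaining moves has a fixed parity, and likewise if all are even.
  In the remaining, undecided, case an involution can be adjoined to make all of them even.
  The only other question is whether one move can also make all of them odd.

  Call a position odd-forced if every maximal subgroup above it has odd order, and odd-reachable
  if one more element makes it an odd-forced position. Then the nim-number of \<open>P\<close> is given
  by the following table (lemma \<open>dng_nim_eq_dng_value\<close>):

  \<^item> \<open>P\<close> odd-forced: 1 if \<open>|P|\<close> is even, 0 if it is odd;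
  \<^item> \<open>P\<close> odd-reachable but not odd-forced: 3 if \<open>|P|\<close> is even, 2 if it is odd;
  \<^item> otherwise: 0 if \<open>|P|\<close> is even, 1 if it is odd.

  The value of the game is the entry for the empty set, so what remains is group theory.
  The empty set is odd-forced iff no maximal subgroup has even order, which by Cauchy's theorem
  happens iff \<open>|G|\<close> is 2 or odd. If the even maximal subgroups cover \<open>G\<close>, no
  single element is odd-forced. In a cyclic group of order \<open>4n\<close> every maximal subgroup is
  even, so again no position is odd-forced. Finally, suppose that \<open>G\<close> has an element \<open>h\<close>
  outside every even maximal subgroup. Unless \<open>h\<close> generates \<open>G\<close>, the singleton
  \<open>{h}\<close> is an odd-forced position. If \<open>h\<close> does generate \<open>G\<close> and
  \<open>|G| = 2m\<close> with \<open>m\<close> odd, the same is true of \<open>{h\<^sup>2}\<close>.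
\<close>

lemma mex_eqI:
  assumes "n \<notin> A" and "\<And>k. k < n \<Longrightarrow> k \<in> A"
  shows "mex A = n"
  unfolding mex_def
proof (rule Least_equality)
  show "n \<le> k" if "k \<notin> A" for k
    using assms(2)[of k] that by (cases "k < n") auto
qed (rule assms(1))

section \<open>Finite groups and their maximal subgroups\<close>

lemma cyclic_integer_mod_group: "cyclic_group (integer_mod_group n)"
proof -
  let ?Z = "integer_mod_group n" and ?x = "1 mod int n"
  have "?x [^]\<^bsub>?Z\<^esub> m = m mod int n" for m :: int
    by (simp add: int_pow_integer_mod_group mod_mult_right_eq)
  moreover have "carrier ?Z = range (\<lambda>m. m mod int n)"
  proof
    show "carrier ?Z \<subseteq> range (\<lambda>m. m mod int n)"
    proof
      fix k assume "k \<in> carrier ?Z"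
      then have "k = k mod int n"
        by (simp add: carrier_integer_mod_group split: if_splits)
      then show "k \<in> range (\<lambda>m. m mod int n)"
        by (rule range_eqI)
    qed
  qed (auto simp: carrier_integer_mod_group)
  ultimately have "carrier ?Z = range (\<lambda>m::int. ?x [^]\<^bsub>?Z\<^esub> m)" "?x \<in> carrier ?Z"
    by auto
  then show ?thesis
    using group.cyclic_group[OF group_integer_mod_group] by blast
qed

locale finite_group = group +
  assumes fin: "finite (carrier G)"
begin

lemma finite_subgroup: "subgroup H G \<Longrightarrow> finite H"
  using fin subgroup.subset finite_subset by blast

lemma card_subgroup_dvd:
  assumes "subgroup H G" "subgroup K G" "H \<subseteq> K"
  shows "card H dvd card K"
proof -
  interpret K: group "G\<lparr>carrier := K\<rparr>"
    by (rule subgroup_imp_group[OF assms(2)])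
  have "subgroup H (G\<lparr>carrier := K\<rparr>)"
    using assms by (intro subgroup_incl)
  from K.lagrange[OF this] have "\<exists>i. i * card H = card K"
    by (auto simp: order_def)
  then show ?thesis
    by (metis dvd_triv_right)
qed

lemma ord_dvd_card_subgroup:
  assumes "subgroup K G" "x \<in> K"
  shows "ord x dvd card K"
proof -
  have x: "x \<in> carrier G"
    using assms subgroup.mem_carrier by metis
  have "card (generate G {x}) dvd card K"
    using assms x by (intro card_subgroup_dvd generate_is_subgroup generate_subgroup_incl) auto
  then show ?thesis
    by (simp add: generate_pow_card x)
qed

text \<open>Cauchy's theorem for the prime 2, read off from a subgroup of order two.\<close>

lemma even_subgroup_has_involution:
  assumes K: "subgroup K G" and "even (card K)"
  obtains t where "t \<in> K" "ord t = 2"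
proof -
  obtain m where "card K = 2 ^ 1 * m"
    using assms(2) by auto
  then obtain H where H: "subgroup H (G\<lparr>carrier := K\<rparr>)" "card H = 2"
    using sylow_thm[of 2 "G\<lparr>carrier := K\<rparr>" 1 m] subgroup_imp_group[OF K] finite_subgroup[OF K]
    by (auto simp: order_def)
  have HG: "subgroup H G"
    using incl_subgroup[OF K H(1)] .
  have "\<not> H \<subseteq> {\<one>}"
    using H(2) card_mono[of "{\<one>}" H] by auto
  then obtain t where t: "t \<in> H" "t \<noteq> \<one>"
    by blast
  have "t \<in> carrier G"
    using HG t subgroup.mem_carrier by metis
  then have "ord t \<noteq> 1"
    using t ord_eq_1 by blast
  moreover have "ord t dvd 2"
    using ord_dvd_card_subgroup[OF HG t(1)] H(2) by simp
  ultimately have "ord t = 2"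
    using prime_nat_iff two_is_prime_nat by blast
  moreover have "t \<in> K"
    using subgroup.subset[OF H(1)] t by auto
  ultimately show ?thesis
    using that by blast
qed

lemma maximal_subgroup_subgroup: "maximal_subgroup M G \<Longrightarrow> subgroup M G"
  by (simp add: maximal_subgroup_def)

lemma maximal_subgroup_above:
  assumes "subgroup H G" "H \<noteq> carrier G"
  obtains M where "maximal_subgroup M G" "H \<subseteq> M"
proof -
  let ?S = "{K. subgroup K G \<and> K \<noteq> carrier G \<and> H \<subseteq> K}"
  have "?S \<subseteq> Pow (carrier G)"
    by (auto dest: subgroup.subset)
  then have "finite ?S"
    by (rule finite_subset) (simp add: fin)
  moreover have "H \<in> ?S"
    using assms by simp
  ultimately have "\<exists>M\<in>?S. H \<subseteq> M \<and> (\<forall>K\<in>?S. M \<subseteq> K \<longrightarrow> M = K)"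
    by (rule finite_has_maximal2)
  then obtain M where M: "M \<in> ?S" "\<forall>K\<in>?S. M \<subseteq> K \<longrightarrow> M = K"
    by (elim bexE conjE)
  have "K = M \<or> K = carrier G" if "subgroup K G" "M \<subseteq> K" for K
  proof (rule ccontr)
    assume K: "\<not> (K = M \<or> K = carrier G)"
    then have "K \<in> ?S"
      using M(1) that by auto
    then show False
      using M(2) that(2) K by metis
  qed
  then have "maximal_subgroup M G"
    using M(1) by (simp add: maximal_subgroup_def)
  then show ?thesis
    using that[of M] M(1) by simp
qed

lemma dng_positions_iff_maximal:
  "P \<in> dng_positions G \<longleftrightarrow> (\<exists>M. maximal_subgroup M G \<and> P \<subseteq> M)"
proof
  assume "P \<in> dng_positions G"
  then have P: "P \<subseteq> carrier G" "generate G P \<noteq> carrier G"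
    by (auto simp: dng_positions_def)
  then obtain M where "maximal_subgroup M G" "generate G P \<subseteq> M"
    using maximal_subgroup_above[OF generate_is_subgroup] by metis
  moreover have "P \<subseteq> generate G P"
    by (auto intro: generate.incl)
  ultimately show "\<exists>M. maximal_subgroup M G \<and> P \<subseteq> M"
    by blast
next
  assume "\<exists>M. maximal_subgroup M G \<and> P \<subseteq> M"
  then obtain M where M: "subgroup M G" "M \<noteq> carrier G" "P \<subseteq> M"
    by (auto simp: maximal_subgroup_def)
  then have "generate G P \<subseteq> M" "M \<subseteq> carrier G"
    using generate_subgroup_incl[of P M] subgroup.subset[of M G] by blast+
  then show "P \<in> dng_positions G"
    using M(2,3) unfolding dng_positions_def by blast
qed

section \<open>Nim-numbers of positions\<close>

definition odd_forced :: "'a set \<Rightarrow> bool"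
  where "odd_forced P \<longleftrightarrow> (\<forall>M. maximal_subgroup M G \<longrightarrow> P \<subseteq> M \<longrightarrow> odd (card M))"

definition odd_reachable :: "'a set \<Rightarrow> bool"
  where "odd_reachable P \<longleftrightarrow> (\<exists>h. insert h P \<in> dng_positions G \<and> odd_forced (insert h P))"

definition dng_value :: "'a set \<Rightarrow> nat"
  where "dng_value P =
    (if odd_forced P then (if even (card P) then 1 else 0)
     else if odd_reachable P then (if even (card P) then 3 else 2)
     else (if even (card P) then 0 else 1))"

lemma odd_forced_mono: "odd_forced P \<Longrightarrow> P \<subseteq> Q \<Longrightarrow> odd_forced Q"
  unfolding odd_forced_def by blast

lemma dng_opts_iff:
  "Q \<in> dng_opts G P \<longleftrightarrow> (\<exists>x. x \<notin> P \<and> Q = insert x P \<and> Q \<in> dng_positions G)"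
  by (force simp: dng_opts_def dng_positions_def)

lemma finite_dng_position: "P \<in> dng_positions G \<Longrightarrow> finite P"
  by (auto simp: dng_positions_def intro: finite_subset[OF _ fin])

lemma card_dng_opt:
  assumes "P \<in> dng_positions G" "Q \<in> dng_opts G P"
  shows "card Q = Suc (card P)"
  using assms finite_dng_position[OF assms(1)] by (auto simp: dng_opts_iff)

lemma even_maximal_subgroupI:
  assumes "maximal_subgroup M G" "t \<in> M" "ord t = 2"
  shows "even (card M)"
  using ord_dvd_card_subgroup[of M t] assms maximal_subgroup_subgroup by simp

lemma involution_not_odd_reachable:
  assumes "t \<in> P" "ord t = 2"
  shows "\<not> odd_reachable P"
  unfolding odd_reachable_def odd_forced_def dng_positions_iff_maximal
  using assms even_maximal_subgroupI by blast

text \<open>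
  Below an even maximal subgroup, the move that decides the game is to adjoin an involution.
  If one is present already, then \<open>P\<close> is not odd-reachable, so \<open>|P|\<close> is odd.
  Then \<open>P\<close> does not exhaust the subgroup, and any move inside it will do.
\<close>

lemma even_forcing_opt:
  assumes M: "maximal_subgroup M G" "P \<subseteq> M" "even (card M)"
    and P: "odd (card P) \<or> odd_reachable P"
  obtains Q where "Q \<in> dng_opts G P" "\<not> odd_forced Q" "\<not> odd_reachable Q"
proof -
  obtain t where t: "t \<in> M" "ord t = 2"
    using even_subgroup_has_involution M maximal_subgroup_subgroup by metis
  obtain x where x: "x \<in> M" "x \<notin> P" "t \<in> insert x P"
  proof (cases "t \<in> P")
    case True
    then have "P \<noteq> M"
      using P M(3) involution_not_odd_reachable t by auto
    then show ?thesis
      using that M(2) True by blast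
  next
    case False
    then show ?thesis
      using that t by blast
  qed
  have "insert x P \<in> dng_opts G P"
    using x M by (auto simp: dng_opts_iff dng_positions_iff_maximal)
  moreover have "\<not> odd_forced (insert x P)"
    using x M by (auto simp: odd_forced_def)
  ultimately show ?thesis
    using that involution_not_odd_reachable x(3) t(2) by blast
qed

text \<open>
  A move that changes nothing but the parity of \<open>|P|\<close>: the intersection of all maximal
  subgroups above \<open>P\<close> has odd order, as one of them does, so a set of even size does not
  exhaust it. Adjoining an element of the intersection keeps the family of maximal subgroups.
\<close>

lemma parity_changing_opt:
  assumes N: "maximal_subgroup N G" "P \<subseteq> N" "odd (card N)" and P: "even (card P)"
  obtains x where "insert x P \<in> dng_opts G P"
    "\<And>M. maximal_subgroup M G \<Longrightarrow> P \<subseteq> M \<Longrightarrow> x \<in> M"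
proof -
  let ?A = "{M. maximal_subgroup M G \<and> P \<subseteq> M}"
  have "subgroup (\<Inter>?A) G"
    using N by (intro subgroups_Inter) (auto dest: maximal_subgroup_subgroup)
  then have "card (\<Inter>?A) dvd card N"
    using N by (intro card_subgroup_dvd) (auto dest: maximal_subgroup_subgroup)
  then have "odd (card (\<Inter>?A))"
    using N(3) dvd_trans by blast
  then have "P \<noteq> \<Inter>?A"
    using P by metis
  then obtain x where x: "x \<notin> P" "x \<in> \<Inter>?A"
    by blast
  then have "insert x P \<in> dng_opts G P"
    using N by (auto simp: dng_opts_iff dng_positions_iff_maximal)
  then show ?thesis
    using that x(2) by blast
qed

lemma odd_forcing_opt:
  assumes "\<not> odd_forced P" "odd_reachable P"
  obtains Q where "Q \<in> dng_opts G P" "odd_forced Q"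
proof -
  obtain h where h: "insert h P \<in> dng_positions G" "odd_forced (insert h P)"
    using assms(2) by (auto simp: odd_reachable_def)
  then have "h \<notin> P"
    using assms(1) by (auto simp: insert_absorb)
  then show ?thesis
    using that h by (auto simp: dng_opts_iff)
qed

text \<open>
  The move that yields the option of value 2 for a position of value 3: a change of parity keeps
  the position both odd-reachable and not odd-forced.
\<close>

lemma odd_reachable_opt:
  assumes P: "\<not> odd_forced P" "odd_reachable P" "even (card P)"
  obtains Q where "Q \<in> dng_opts G P" "\<not> odd_forced Q" "odd_reachable Q"
proof -
  obtain h where h: "insert h P \<in> dng_positions G" "odd_forced (insert h P)"
    using P(2) by (auto simp: odd_reachable_def)
  then obtain N where N: "maximal_subgroup N G" "insert h P \<subseteq> N" "odd (card N)"
    by (auto simp: dng_positions_iff_maximal odd_forced_def)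
  then obtain x where x: "insert x P \<in> dng_opts G P"
    "\<And>M. maximal_subgroup M G \<Longrightarrow> P \<subseteq> M \<Longrightarrow> x \<in> M"
    using parity_changing_opt[of N P] P(3) by blast
  have "\<not> odd_forced (insert x P)"
    using P(1) x(2) by (auto simp: odd_forced_def)
  moreover have "insert h (insert x P) \<in> dng_positions G"
    using N x(2) by (auto simp: dng_positions_iff_maximal)
  moreover have "odd_forced (insert h (insert x P))"
    using h(2) by (rule odd_forced_mono) blast
  ultimately show ?thesis
    using that x(1) unfolding odd_reachable_def by blast
qed

text \<open>
  The table of values satisfies the mex recursion. Every value below the claimed one is attained
  by an option from the preceding lemmas. The claimed value itself is avoided because each move
  changes the parity of the size, because odd-forced positions stay so, and because an odd-forced
  option is available only from an odd-forced or odd-reachable position.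
\<close>

lemma mex_dng_value:
  assumes P: "P \<in> dng_positions G"
  shows "mex (dng_value ` dng_opts G P) = dng_value P"
proof -
  have par: "even (card Q) \<longleftrightarrow> odd (card P)" if "Q \<in> dng_opts G P" for Q
    using card_dng_opt[OF P that] by simp
  have avoid: "dng_value P \<notin> dng_value ` dng_opts G P"
  proof
    assume "dng_value P \<in> dng_value ` dng_opts G P"
    then obtain Q where Q: "Q \<in> dng_opts G P" "dng_value Q = dng_value P"
      by (metis imageE)
    obtain x where x: "Q = insert x P" "Q \<in> dng_positions G"
      using Q(1) unfolding dng_opts_iff by blast
    have "odd_forced Q" if "odd_forced P"
      using that by (rule odd_forced_mono) (simp add: x(1) subset_insertI)
    moreover have "odd_reachable P" if "odd_forced Q"
      using that x unfolding odd_reachable_def by blast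
    ultimately show False
      using Q(2) par[OF Q(1)] unfolding dng_value_def
      by (cases "odd_forced P"; cases "odd_forced Q") (simp_all split: if_splits)
  qed
  show ?thesis
  proof (cases "odd_forced P")
    case forced: True
    show ?thesis
    proof (rule mex_eqI[OF avoid])
      fix k assume k: "k < dng_value P"
      then have "k = 0" and even: "even (card P)"
        using forced by (cases "even (card P)"; simp add: dng_value_def)+
      obtain N where N: "maximal_subgroup N G" "P \<subseteq> N"
        using P by (auto simp: dng_positions_iff_maximal)
      then have "odd (card N)"
        using forced by (simp add: odd_forced_def)
      then obtain x where x: "insert x P \<in> dng_opts G P"
        using parity_changing_opt[OF N _ even] by metis
      moreover have "odd_forced (insert x P)"
        using forced by (rule odd_forced_mono) blast
      ultimately have "dng_value (insert x P) = 0"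
        using par[OF x] even by (simp add: dng_value_def)
      then show "k \<in> dng_value ` dng_opts G P"
        using imageI[OF x, of dng_value] \<open>k = 0\<close> by (simp only:)
    qed
  next
    case nforced: False
    then obtain M where M: "maximal_subgroup M G" "P \<subseteq> M" "even (card M)"
      by (auto simp: odd_forced_def)
    have even_move: "(if even (card P) then 1 else 0) \<in> dng_value ` dng_opts G P"
      if move: "odd (card P) \<or> odd_reachable P"
    proof -
      obtain Q where Q: "Q \<in> dng_opts G P" "\<not> odd_forced Q" "\<not> odd_reachable Q"
        using even_forcing_opt[OF M move] by blast
      then have "dng_value Q = (if even (card P) then 1 else 0)"
        using par[OF Q(1)] by (simp add: dng_value_def)
      then show ?thesis
        using imageI[OF Q(1), of dng_value] by (simp only:)
    qed
    show ?thesis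
    proof (cases "odd_reachable P")
      case False
      show ?thesis
      proof (rule mex_eqI[OF avoid])
        fix k assume "k < dng_value P"
        then have "k = 0" "odd (card P)"
          using nforced False by (cases "even (card P)"; simp add: dng_value_def)+
        then show "k \<in> dng_value ` dng_opts G P"
          using even_move by simp
      qed
    next
      case reach: True
      obtain Q where Q: "Q \<in> dng_opts G P" "odd_forced Q"
        using odd_forcing_opt[OF nforced reach] by blast
      then have "dng_value Q = (if even (card P) then 0 else 1)"
        using par[OF Q(1)] by (simp add: dng_value_def)
      then have odd_move: "(if even (card P) then 0 else 1) \<in> dng_value ` dng_opts G P"
        using imageI[OF Q(1), of dng_value] by (simp only:)
      have parity_move: "2 \<in> dng_value ` dng_opts G P" if even: "even (card P)"
      proof -
        obtain R where R: "R \<in> dng_opts G P" "\<not> odd_forced R" "odd_reachable R"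
          using odd_reachable_opt[OF nforced reach even] by blast
        then have "dng_value R = 2"
          using par[OF R(1)] even by (simp add: dng_value_def)
        then show ?thesis
          using imageI[OF R(1), of dng_value] by (simp only:)
      qed
      show ?thesis
      proof (rule mex_eqI[OF avoid])
        fix k assume k: "k < dng_value P"
        show "k \<in> dng_value ` dng_opts G P"
        proof (cases "even (card P)")
          case True
          then have "k = 0 \<or> k = 1 \<or> k = 2"
            using k nforced reach by (simp add: dng_value_def) arith
          then show ?thesis
            using True odd_move even_move reach parity_move by auto
        next
          case False
          then have "k = 0 \<or> k = 1"
            using k nforced reach by (simp add: dng_value_def) arith
          then show ?thesis
            using False odd_move even_move by auto
        qed
      qed
    qed
  qed
qed

lemma dng_nim_eq_dng_value:
  "P \<in> dng_positions G \<Longrightarrow> dng_nim G P = dng_value P"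
proof (induction "card (carrier G - P)" arbitrary: P rule: less_induct)
  case less
  have "dng_nim G Q = dng_value Q" if "Q \<in> dng_opts G P" for Q
    using that less.hyps dng_opts_decrease[OF fin that] by (simp add: dng_opts_def)
  then have "dng_nim G ` dng_opts G P = dng_value ` dng_opts G P"
    by (rule image_cong[OF refl])
  then show ?case
    using mex_dng_value[OF less.prems] fin by (subst dng_nim.simps) simp
qed

lemma DNG_eq:
  assumes "carrier G \<noteq> {\<one>}"
  shows "DNG G = (if odd_forced {} then 1 else if odd_reachable {} then 3 else 0)"
proof -
  have "{} \<in> dng_positions G"
    using assms by (simp add: dng_positions_def generate_empty)
  then show ?thesis
    by (simp add: DNG_def dng_nim_eq_dng_value dng_value_def)
qed

section \<open>Parities of maximal subgroups\<close>

lemma odd_forced_empty_iff: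
  assumes "carrier G \<noteq> {\<one>}"
  shows "odd_forced {} \<longleftrightarrow> order G = 2 \<or> odd (order G)"
proof
  assume forced: "odd_forced {}"
  show "order G = 2 \<or> odd (order G)"
  proof (rule ccontr)
    assume G: "\<not> (order G = 2 \<or> odd (order G))"
    then have "even (card (carrier G))"
      by (simp add: order_def)
    then obtain t where t: "t \<in> carrier G" "ord t = 2"
      by (rule even_subgroup_has_involution[OF subgroup_self])
    then have "card (generate G {t}) \<noteq> card (carrier G)"
      using G by (simp add: generate_pow_card[symmetric] order_def)
    then have "{t} \<in> dng_positions G"
      using t by (auto simp: dng_positions_def)
    then obtain M where "maximal_subgroup M G" "t \<in> M"
      by (auto simp: dng_positions_iff_maximal)
    then show False
      using forced even_maximal_subgroupI t(2) by (auto simp: odd_forced_def)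
  qed
next
  assume G: "order G = 2 \<or> odd (order G)"
  have "odd (card M)" if M: "maximal_subgroup M G" for M
  proof
    assume "even (card M)"
    have sub: "subgroup M G" "M \<noteq> carrier G"
      using M by (auto simp: maximal_subgroup_def)
    have dvd: "card M dvd order G"
      using card_subgroup_dvd[OF sub(1) subgroup_self] sub by (simp add: order_def subgroup.subset)
    then have "order G = 2"
      using G \<open>even (card M)\<close> dvd_trans by blast
    then have "card M = card (carrier G)"
      using dvd \<open>even (card M)\<close> by (simp add: order_def dvd_antisym)
    then show False
      using card_subset_eq[OF fin subgroup.subset[OF sub(1)]] sub(2) by blast
  qed
  then show "odd_forced {}"
    by (simp add: odd_forced_def)
qed

lemma covered_not_odd_reachable_empty:
  assumes "covers {M. maximal_subgroup M G \<and> even (card M)} G"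
  shows "\<not> odd_reachable {}"
proof
  assume "odd_reachable {}"
  then obtain h where h: "{h} \<in> dng_positions G" "odd_forced {h}"
    by (auto simp: odd_reachable_def)
  then have "h \<in> carrier G"
    by (simp add: dng_positions_def)
  then obtain M where "maximal_subgroup M G" "even (card M)" "h \<in> M"
    using assms by (auto simp: covers_def)
  then show False
    using h(2) by (auto simp: odd_forced_def)
qed

text \<open>
  With \<open>t\<close> the involution of a cyclic group of order \<open>4n\<close> and \<open>c\<close> a
  generator, the square roots of elements of a maximal subgroup \<open>M\<close> form a subgroup above
  \<open>M\<close>. It equals \<open>M\<close>, and then contains \<open>t\<close> as a square root of 1, or it
  equals the whole group, and then \<open>M\<close> contains \<open>t\<close> as a power of
  \<open>c\<^sup>2\<close>, because \<open>2n\<close> is even.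
\<close>

lemma cyclic_maximal_subgroup_even:
  assumes cyc: "cyclic_group G" and ord: "order G = 4 * n" and M: "maximal_subgroup M G"
  shows "even (card M)"
proof -
  interpret comm_group G
    using cyclic_imp_abelian_group[OF cyc] .
  have sub: "subgroup M G"
    using M by (rule maximal_subgroup_subgroup)
  obtain c where c: "c \<in> carrier G" "subgroup_generated G {c} = G"
    using cyc by (auto simp: cyclic_group_def)
  then have "ord c = 4 * n"
    using cyclic_order_is_ord[OF c(1)] ord by simp
  moreover have "n > 0"
    using ord fin order_gt_0_iff_finite by (metis gr0I mult_0_right less_irrefl)
  ultimately have t: "ord (c [^] (2 * n)) = 2"
    using ord_pow[OF c(1), of "2 * n"] by simp
  let ?t = "c [^] (2 * n)"
  let ?K = "{x \<in> carrier G. x [^] (2::nat) \<in> M}"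
  have "subgroup ?K G"
  proof (rule subgroupI)
    have "\<one> \<in> ?K"
      using subgroup.one_closed[OF sub] by simp
    then show "?K \<noteq> {}"
      by blast
  qed (use sub in \<open>auto simp: nat_pow_inv nat_pow_distrib subgroup.m_closed subgroup.m_inv_closed\<close>)
  moreover have "M \<subseteq> ?K"
    using sub by (auto simp: numeral_2_eq_2 subgroup.mem_carrier subgroup.m_closed)
  ultimately consider "?K = M" | "?K = carrier G"
    using M unfolding maximal_subgroup_def by blast
  then have "?t \<in> M"
  proof cases
    case 1
    have "?t [^] (2::nat) = \<one>"
      using t c(1) pow_ord_eq_1[of ?t] by simp
    then have "?t \<in> ?K"
      using c(1) subgroup.one_closed[OF sub] by simp
    then show ?thesis
      using 1 by blast
  next
    case 2
    then have "c [^] (2::nat) \<in> M"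
      using c(1) by blast
    then have "(c [^] (2::nat)) [^] n \<in> M"
      using sub by (induction n) (simp_all add: subgroup.one_closed subgroup.m_closed)
    then show ?thesis
      using c(1) by (simp add: nat_pow_pow)
  qed
  then show ?thesis
    using even_maximal_subgroupI[OF M _ t] by blast
qed

lemma generator_iso_integer_mod_group:
  assumes h: "h \<in> carrier G" "generate G {h} = carrier G"
  shows "G \<cong> integer_mod_group (order G)"
proof -
  let ?N = "order G"
  let ?Z = "integer_mod_group ?N"
  let ?f = "\<lambda>k::int. h [^] k"
  have N: "?N > 0"
    using fin order_gt_0_iff_finite by blast
  have pow_mod: "h [^] (k mod int ?N) = h [^] k" for k :: int
  proof -
    have "h [^] int ?N = \<one>"
      using pow_order_eq_1[OF h(1)] by (simp add: int_pow_int)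
    then have "h [^] (int ?N * (k div int ?N)) = \<one>"
      using h(1) by (simp flip: int_pow_pow)
    moreover have "h [^] k = h [^] (int ?N * (k div int ?N)) \<otimes> h [^] (k mod int ?N)"
      using h(1) by (simp flip: int_pow_mult)
    ultimately show ?thesis
      using h(1) by simp
  qed
  have "?f \<in> hom ?Z G"
    using h(1) by (auto simp: hom_def pow_mod int_pow_mult)
  moreover have surj: "?f ` carrier ?Z = carrier G"
  proof
    show "?f ` carrier ?Z \<subseteq> carrier G"
      using h(1) by auto
    show "carrier G \<subseteq> ?f ` carrier ?Z"
    proof
      fix x assume "x \<in> carrier G"
      then obtain k :: int where "x = h [^] k"
        using h generate_pow[OF h(1)] by auto
      then have "x = ?f (k mod int ?N)"
        by (simp add: pow_mod)
      moreover have "k mod int ?N \<in> carrier ?Z"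
        using N by (simp add: carrier_integer_mod_group)
      ultimately show "x \<in> ?f ` carrier ?Z"
        by blast
    qed
  qed
  moreover have "inj_on ?f (carrier ?Z)"
    using surj N by (intro eq_card_imp_inj_on) (auto simp: carrier_integer_mod_group order_def)
  ultimately have "?f \<in> iso ?Z G"
    by (simp add: iso_iff)
  then show ?thesis
    using group.iso_sym[OF group_integer_mod_group] is_isoI by blast
qed

text \<open>
  The square of a generator has odd order \<open>m\<close>. An even maximal subgroup containing it
  would have order divisible by both \<open>m\<close> and 2, hence be the whole group.
\<close>

lemma generator_square_odd_forced:
  assumes h: "h \<in> carrier G" "generate G {h} = carrier G"
    and ord: "order G = 2 * m" "odd m"
  shows "{h [^] (2::nat)} \<in> dng_positions G" "odd_forced {h [^] (2::nat)}"
proof -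
  have "ord h = 2 * m"
    using generate_pow_card[OF h(1)] h(2) ord by (simp add: order_def)
  then have ord2: "ord (h [^] (2::nat)) = m"
    using ord_pow[OF h(1), of 2] by simp
  have "m > 0"
    using ord(2) by (cases m) auto
  have "card (generate G {h [^] (2::nat)}) \<noteq> card (carrier G)"
    using generate_pow_card[of "h [^] (2::nat)"] h(1) ord2 ord(1) \<open>m > 0\<close> by (simp add: order_def)
  then show "{h [^] (2::nat)} \<in> dng_positions G"
    using h(1) by (auto simp: dng_positions_def)
  show "odd_forced {h [^] (2::nat)}"
    unfolding odd_forced_def
  proof (intro allI impI notI)
    fix M assume M: "maximal_subgroup M G" "{h [^] (2::nat)} \<subseteq> M" "even (card M)"
    have sub: "subgroup M G" "M \<noteq> carrier G"
      using M by (auto simp: maximal_subgroup_def)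
    have "m dvd card M"
      using ord_dvd_card_subgroup[OF sub(1), of "h [^] (2::nat)"] M(2) ord2 by simp
    then have "2 * m dvd card M"
      using M(3) ord(2) by (intro divides_mult) auto
    moreover have "card M dvd 2 * m"
      using card_subgroup_dvd[OF sub(1) subgroup_self subgroup.subset[OF sub(1)]] ord(1)
      by (simp add: order_def)
    ultimately have "card M = card (carrier G)"
      using ord(1) dvd_antisym by (metis order_def)
    then show False
      using card_subset_eq[OF fin subgroup.subset[OF sub(1)]] sub(2) by blast
  qed
qed

lemma odd_reachable_emptyI:
  assumes even: "even (order G)"
    and ncyc: "\<not> (\<exists>n\<ge>1. G \<cong> integer_mod_group (4 * n))"
    and ncov: "\<not> covers {M. maximal_subgroup M G \<and> even (card M)} G"
  shows "odd_reachable {}"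
proof -
  have "\<Union>{M. maximal_subgroup M G \<and> even (card M)} \<subseteq> carrier G"
    using maximal_subgroup_subgroup subgroup.subset by blast
  then obtain h where h: "h \<in> carrier G" "odd_forced {h}"
    using ncov unfolding covers_def odd_forced_def by blast
  show ?thesis
  proof (cases "generate G {h} = carrier G")
    case False
    then have "{h} \<in> dng_positions G"
      using h(1) by (simp add: dng_positions_def)
    then show ?thesis
      using h(2) by (auto simp: odd_reachable_def)
  next
    case True
    obtain m where m: "order G = 2 * m"
      using even by blast
    have "odd m"
    proof
      assume "even m"
      then obtain n where "order G = 4 * n"
        using m by auto
      moreover have "order G > 0"
        using fin order_gt_0_iff_finite by blast
      ultimately show False
        using generator_iso_integer_mod_group[OF h(1) True] ncyc by (cases n) auto
    qed
    then show ?thesis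
      using generator_square_odd_forced[OF h(1) True m] unfolding odd_reachable_def by blast
  qed
qed

lemma cyclic_4n_not_odd_reachable:
  assumes "G \<cong> integer_mod_group (4 * n)" "n \<ge> 1"
  shows "even (order G)" "order G \<noteq> 2" "\<not> odd_reachable {}"
proof -
  have ord: "order G = 4 * n"
    using iso_same_card[OF assms(1)] assms(2) by (simp add: order_def carrier_integer_mod_group)
  then show "even (order G)" "order G \<noteq> 2"
    by presburger+
  have "cyclic_group G"
    using isomorphic_group_cyclicity[OF assms(1)] cyclic_integer_mod_group is_group by simp
  then have "even (card M)" if "maximal_subgroup M G" for M
    using cyclic_maximal_subgroup_even ord that by blast
  then show "\<not> odd_reachable {}"
    by (auto simp: odd_reachable_def odd_forced_def dng_positions_iff_maximal)
qed

lemma covered_not_odd_forced_empty: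
  assumes "covers {M. maximal_subgroup M G \<and> even (card M)} G"
  shows "\<not> odd_forced {}"
  using assms one_closed by (auto simp: covers_def odd_forced_def)

end

section \<open>The value of the game\<close>

theorem theorem6p3:
  fixes G :: "('a, 'b) monoid_scheme"
  assumes "group G" and "finite (carrier G)" and "carrier G \<noteq> {\<one>\<^bsub>G\<^esub>}"
  shows "(order G = 2 \<or> odd (order G) \<longrightarrow> DNG G = 1)
    \<and> ((\<exists>n::nat. n \<ge> 1 \<and> G \<cong> integer_mod_group (4 * n))
         \<or> covers {M. maximal_subgroup M G \<and> even (card M)} G \<longrightarrow> DNG G = 0)
    \<and> (\<not> (order G = 2 \<or> odd (order G))
         \<and> \<not> ((\<exists>n::nat. n \<ge> 1 \<and> G \<cong> integer_mod_group (4 * n))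
              \<or> covers {M. maximal_subgroup M G \<and> even (card M)} G)
       \<longrightarrow> DNG G = 3)"
proof -
  interpret finite_group G
    using assms(1,2) by (intro finite_group.intro finite_group_axioms.intro)
  note DNG = DNG_eq[OF assms(3)] and forced = odd_forced_empty_iff[OF assms(3)]
  have "DNG G = 1" if "order G = 2 \<or> odd (order G)"
    using that DNG forced by simp
  moreover have "DNG G = 0" if "n \<ge> 1" "G \<cong> integer_mod_group (4 * n)" for n
    using DNG forced cyclic_4n_not_odd_reachable[OF that(2,1)] by simp
  moreover have "DNG G = 0" if "covers {M. maximal_subgroup M G \<and> even (card M)} G"
    using that DNG covered_not_odd_forced_empty covered_not_odd_reachable_empty by simp
  moreover have "DNG G = 3" if "\<not> (order G = 2 \<or> odd (order G))"
    "\<not> (\<exists>n::nat. n \<ge> 1 \<and> G \<cong> integer_mod_group (4 * n))"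
    "\<not> covers {M. maximal_subgroup M G \<and> even (card M)} G"
    using that DNG forced odd_reachable_emptyI by simp
  ultimately show ?thesis
    by blast
qed

end
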